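(* Given $A \in \mathbb{C}^{n\times n}$ such that $L_f(A,\cdot)$ is well defined, $\mathbf{b}, \mathbf{c} \in \mathbb{C}^n$ and $E \in \mathbb{C}^{n\times n}$, it holds that $$\mathbf{c}^* L_f(A,E)\,\mathbf{b} = \langle L_f(A^*, \mathbf{c}\mathbf{b}^* ),\, E \rangle .$$
   Context: $f$ is a scalar function analytic in an open region containing the eigenvalues of the matrix at which it is evaluated, and $f(A)$ denotes the corresponding matrix function. The Fréchet derivative of $f$ at $A \in \mathbb{C}^{n\times n}$ is the unique linear operator $L_f(A,\cdot): \mathbb{C}^{n\times n} \to \mathbb{C}^{n\times n}$ such that $f(A+\varepsilon E) - f(A) = \varepsilon L_f(A,E) + \mathcal{O}(\varepsilon^2)$ holds for every $E \in \mathbb{C}^{n\times n}$ and sufficiently small $\varepsilon > 0$; $L_f(A^*,\cdot)$ is the Fréchet derivative of $f$ at $A^*$. $\langle X, Y\rangle = \mathrm{trace}(X^* Y)$ is the trace inner product on $\mathbb{C}^{n\times n}$, and $X^*$ is the conjugate transpose of $X$.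
   Formalization: The formal theorem adds the hypothesis that f(conj z) = conj f(z) whenever z and conj z lie in the open set where f is analytic; without it the claim is false, e.g. n = 1, f(z) = iz, b = c = E = 1 gives i on the left and −i on the right. *)

theory Defs
  imports "HOL-Complex_Analysis.Complex_Analysis" "HOL-Library.Landau_Symbols"
begin

definition eigenvalues :: "complex^'n^'n \<Rightarrow> complex set" where
  "eigenvalues A = {z. \<exists>v. v \<noteq> 0 \<and> A *v v = z *s v}"

definition conj_transpose :: "complex^'n^'m \<Rightarrow> complex^'m^'n" where
  "conj_transpose A = (\<chi> i j. cnj (A $ j $ i))"

definition trace_inner :: "complex^'n^'n \<Rightarrow> complex^'n^'n \<Rightarrow> complex" where
  "trace_inner X Y = trace (conj_transpose X ** Y)"

text \<open>For column vectors \<open>c\<close>, \<open>x\<close>: the number \<open>c\<^sup>* x\<close> and the rank-one matrix \<open>c x\<^sup>*\<close>.\<close>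

definition conj_dot :: "complex^'n \<Rightarrow> complex^'n \<Rightarrow> complex" where
  "conj_dot c x = (\<Sum>i\<in>UNIV. cnj (c $ i) * x $ i)"

definition conj_outer :: "complex^'n \<Rightarrow> complex^'n \<Rightarrow> complex^'n^'n" where
  "conj_outer c x = (\<chi> i j. c $ i * cnj (x $ j))"

text \<open>The matrix function given by the Cauchy integral
  \<open>f(A) = 1/(2\<pi>\<i>) \<integral>\<^sub>\<Gamma> f(z) (z I - A)\<^sup>-\<^sup>1 dz\<close>, taken entrywise, where the cycle \<open>\<Gamma>\<close> consists of one
  small positively oriented circle around each eigenvalue of \<open>A\<close>.  The constant \<^const>\<open>residue\<close> is by
  definition \<open>1/(2\<pi>\<i>)\<close> times the integral over such a circle of any sufficiently small radius.
  The value is meaningful when \<open>f\<close> is analytic on an open set containing the eigenvalues of \<open>A\<close>;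
  note that \<open>mat z\<close> is \<open>z I\<close>.\<close>

definition matrix_fun :: "(complex \<Rightarrow> complex) \<Rightarrow> complex^'n^'n \<Rightarrow> complex^'n^'n" where
  "matrix_fun f A =
     (\<chi> i j. \<Sum>w\<in>eigenvalues A. residue (\<lambda>z. f z * matrix_inv (mat z - A) $ i $ j) w)"

definition matrix_scale :: "complex \<Rightarrow> complex^'n^'n \<Rightarrow> complex^'n^'n" where
  "matrix_scale a X = (\<chi> i j. a * X $ i $ j)"

text \<open>\<open>L\<close> is complex linear and \<open>f(A + \<epsilon>E) - f(A) = \<epsilon> L(E) + O(\<epsilon>\<^sup>2)\<close> as \<open>\<epsilon>\<close> decreases to \<open>0\<close>, for every
  direction \<open>E\<close>; the implied constant may depend on \<open>E\<close>.\<close>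

definition is_frechet_deriv ::
  "(complex \<Rightarrow> complex) \<Rightarrow> complex^'n^'n \<Rightarrow> (complex^'n^'n \<Rightarrow> complex^'n^'n) \<Rightarrow> bool" where
  "is_frechet_deriv f A L \<longleftrightarrow>
     Vector_Spaces.linear matrix_scale matrix_scale L \<and>
     (\<forall>E. (\<lambda>\<epsilon>::real. norm (matrix_fun f (A + \<epsilon> *\<^sub>R E) - matrix_fun f A - \<epsilon> *\<^sub>R L E))
            \<in> O[at_right 0](\<lambda>\<epsilon>. \<epsilon>\<^sup>2))"

definition frechet_well_defined :: "(complex \<Rightarrow> complex) \<Rightarrow> complex^'n^'n \<Rightarrow> bool" where
  "frechet_well_defined f A \<longleftrightarrow> (\<exists>!L. is_frechet_deriv f A L)"

definition frechet_deriv ::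
  "(complex \<Rightarrow> complex) \<Rightarrow> complex^'n^'n \<Rightarrow> complex^'n^'n \<Rightarrow> complex^'n^'n" where
  "frechet_deriv f A = (THE L. is_frechet_deriv f A L)"

end

theory Submission
  imports Defs
begin

text \<open>
  Let \<open>L\<close> be the derivative of \<open>f\<close> at \<open>A\<close>.  Two facts combine.

  The first is a symmetry: \<open>tr(L(E) X) = tr(E L(X))\<close> (lemma \<open>frechet_deriv_trace_symmetric\<close>).
  Small circles around the eigenvalues of \<open>A\<close> also enclose the eigenvalues of all matrices close to
  \<open>A\<close>, because the spectrum is upper semicontinuous (\<open>eventually_eigenvalues_subset\<close>).  By the residue
  theorem the matrix function near \<open>A\<close> is therefore a Cauchy integral over one fixed cycle
  (\<open>trace_matrix_fun\<close>).  The resolvent identity and continuity of the integral in its parameter then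
  give \<open>tr(L(E) X) = 1/(2\<pi>\<i>) \<integral> f(z) tr(R(z) E R(z) X) dz\<close> with \<open>R(z) = (z I - A)\<^sup>-\<^sup>1\<close>, where \<open>E\<close> and \<open>X\<close> may be
  exchanged: \<open>L\<close> is identified as the limit of the difference quotients of these integrals.

  The second is a reflection: \<open>f(B\<^sup>*) = f(B)\<^sup>*\<close> for \<open>B\<close> near \<open>A\<close>, by conjugating residues
  (\<open>matrix_fun_conj_transpose\<close>), so the derivative at \<open>A\<^sup>*\<close> is \<open>X \<mapsto> L(X\<^sup>*)\<^sup>*\<close>.  This is where
  \<open>f(cnj z) = cnj (f z)\<close> enters.

  Together, \<open>\<langle>L\<^sub>f(A\<^sup>*, c b\<^sup>*), E\<rangle> = tr(L(b c\<^sup>*) E) = tr((b c\<^sup>*) L(E)) = c\<^sup>* L(E) b\<close>.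
\<close>

(* The infix dollar sign denotes components of vectors only, not coefficients of power series. *)
no_notation fps_nth (infixl \<open>$\<close> 75)

section \<open>Conjugate transposes and inverses of complex matrices\<close>

lemma conj_transpose_nth [simp]: "conj_transpose M $ i $ j = cnj (M $ j $ i)"
  by (simp add: conj_transpose_def)

lemma conj_transpose_conj_transpose [simp]: "conj_transpose (conj_transpose M) = M"
  by (simp add: vec_eq_iff)

lemma conj_transpose_mult: "conj_transpose (M ** N) = conj_transpose N ** conj_transpose M"
  by (simp add: vec_eq_iff matrix_matrix_mult_def mult.commute)

lemma conj_transpose_mat [simp]: "conj_transpose (mat z) = mat (cnj z)"
  by (auto simp: vec_eq_iff mat_def)

lemma conj_transpose_add: "conj_transpose (M + N) = conj_transpose M + conj_transpose N"
  by (simp add: vec_eq_iff)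

lemma conj_transpose_diff: "conj_transpose (M - N) = conj_transpose M - conj_transpose N"
  by (simp add: vec_eq_iff)

lemma conj_transpose_scaleR: "conj_transpose (a *\<^sub>R M) = a *\<^sub>R conj_transpose M"
  by (simp add: vec_eq_iff)

lemma conj_transpose_matrix_scale:
  "conj_transpose (matrix_scale a M) = matrix_scale (cnj a) (conj_transpose M)"
  by (simp add: vec_eq_iff matrix_scale_def)

lemma norm_conj_transpose [simp]: "norm (conj_transpose M) = norm M"
proof -
  have "(\<Sum>i\<in>UNIV. \<Sum>j\<in>UNIV. (cmod (M $ j $ i))\<^sup>2) = (\<Sum>i\<in>UNIV. \<Sum>j\<in>UNIV. (cmod (M $ i $ j))\<^sup>2)"
    by (rule sum.swap)
  then show ?thesis
    by (simp add: norm_vec_def L2_set_def sum_nonneg)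
qed

lemma matrix_inv_eqI:
  fixes M :: "complex^'n^'n"
  assumes "M ** N = mat 1"
  shows "matrix_inv M = N"
proof -
  have NM: "N ** M = mat 1"
    using assms matrix_left_right_inverse by blast
  have "M ** matrix_inv M = mat 1 \<and> matrix_inv M ** M = mat 1"
    unfolding matrix_inv_def by (rule someI[of _ N]) (simp add: assms NM)
  then show ?thesis
    by (metis NM matrix_mul_assoc matrix_mul_lid matrix_mul_rid)
qed

lemma matrix_inv_cancel:
  fixes M :: "complex^'n^'n"
  assumes "det M \<noteq> 0"
  shows "M ** matrix_inv M = mat 1" "matrix_inv M ** M = mat 1"
  using assms matrix_inv_eqI unfolding invertible_det_nz[symmetric] invertible_def by metis+

lemma matrix_inv_conj_transpose:
  fixes M :: "complex^'n^'n"
  assumes "det M \<noteq> 0"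
  shows "matrix_inv (conj_transpose M) = conj_transpose (matrix_inv M)"
  by (rule matrix_inv_eqI)
    (simp add: conj_transpose_mult[symmetric] matrix_inv_cancel[OF assms])

text \<open>Cramer's rule turns an entry of the inverse into a quotient of polynomials in the entries of the
  matrix.  Continuity of the resolvent jointly in the matrix and the spectral parameter, and its
  holomorphy off the spectrum, both come from this formula.\<close>

lemma matrix_inv_nth:
  fixes M :: "complex^'n^'n"
  assumes "det M \<noteq> 0"
  shows "matrix_inv M $ i $ j
       = det (\<chi> k l. if l = i then (if k = j then 1 else 0) else M $ k $ l) / det M"
proof -
  have "M *v column j (matrix_inv M) = axis j 1"
    using matrix_inv_cancel(1)[OF assms]
    by (simp add: vec_eq_iff column_def matrix_vector_mult_def matrix_matrix_mult_def mat_def axis_def)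
  then have "column j (matrix_inv M)
      = (\<chi> k. det (\<chi> i l. if l = k then axis j 1 $ i else M $ i $ l) / det M)"
    using cramer[OF assms] by blast
  then have "column j (matrix_inv M) $ i = det (\<chi> k l. if l = i then axis j 1 $ k else M $ k $ l) / det M"
    by simp
  moreover have "(\<chi> k l. if l = i then axis j 1 $ k else M $ k $ l)
     = (\<chi> k l. if l = i then (if k = j then 1 else 0) else M $ k $ l)"
    by (simp add: vec_eq_iff axis_def)
  ultimately show ?thesis by (simp add: column_def)
qed

lemma continuous_on_det:
  fixes M :: "'a::topological_space \<Rightarrow> complex^'n^'n"
  assumes "\<And>i j. continuous_on T (\<lambda>x. M x $ i $ j)"
  shows "continuous_on T (\<lambda>x. det (M x :: complex^'n^'n))"
  unfolding det_def by (intro continuous_intros assms)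

lemma continuous_on_matrix_inv_nth:
  fixes M :: "'a::topological_space \<Rightarrow> complex^'n^'n"
  assumes "\<And>i j. continuous_on T (\<lambda>x. M x $ i $ j)"
    and "\<And>x. x \<in> T \<Longrightarrow> det (M x :: complex^'n^'n) \<noteq> 0"
  shows "continuous_on T (\<lambda>x. matrix_inv (M x) $ i $ j)"
proof -
  have entry: "continuous_on T
      (\<lambda>x. (\<chi> k l. if l = i then (if k = j then 1 else 0) else M x $ k $ l) $ k $ l)" for k l
    by (cases "l = i"; cases "k = j") (simp_all add: assms)
  have "continuous_on T (\<lambda>x. det (\<chi> k l. if l = i then (if k = j then 1 else 0) else M x $ k $ l)
           / det (M x))"
    by (intro continuous_on_divide continuous_on_det entry assms ballI)
  then show ?thesis
    by (rule continuous_on_eq) (simp add: matrix_inv_nth assms(2))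
qed

lemma holomorphic_on_det:
  fixes M :: "complex \<Rightarrow> complex^'n^'n"
  assumes "\<And>i j. (\<lambda>z. M z $ i $ j) holomorphic_on T"
  shows "(\<lambda>z. det (M z :: complex^'n^'n)) holomorphic_on T"
  unfolding det_def by (intro holomorphic_intros assms)

lemma holomorphic_on_matrix_inv_nth:
  fixes M :: "complex \<Rightarrow> complex^'n^'n"
  assumes "\<And>i j. (\<lambda>z. M z $ i $ j) holomorphic_on T"
    and "\<And>z. z \<in> T \<Longrightarrow> det (M z :: complex^'n^'n) \<noteq> 0"
  shows "(\<lambda>z. matrix_inv (M z) $ i $ j) holomorphic_on T"
proof -
  have entry:
    "(\<lambda>x. (\<chi> k l. if l = i then (if k = j then 1 else 0) else M x $ k $ l) $ k $ l)
       holomorphic_on T" for k l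
    by (cases "l = i"; cases "k = j") (simp_all add: assms)
  have "(\<lambda>x. det (\<chi> k l. if l = i then (if k = j then 1 else 0) else M x $ k $ l)
           / det (M x)) holomorphic_on T"
    by (intro holomorphic_on_divide holomorphic_on_det entry assms)
  then show ?thesis
    by (rule holomorphic_transform) (simp add: matrix_inv_nth assms(2))
qed

section \<open>Spectrum and resolvent\<close>

lemma eigenvalues_eq_det: "eigenvalues M = {z. det (mat z - M) = 0}"
proof -
  have "z \<in> eigenvalues M \<longleftrightarrow> det (mat z - M) = 0" for z
  proof -
    have "(mat z - M) *v v = z *s v - M *v v" for v
      by (simp add: matrix_vector_mult_diff_rdistrib)
        (simp add: vec_eq_iff matrix_vector_mult_def mat_def if_distrib[where f = "\<lambda>a. a * _"] cong: if_cong)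
    then show ?thesis
      using invertible_det_nz[of "mat z - M"] 
      by (auto simp: eigenvalues_def invertible_left_inverse matrix_left_invertible_ker)
  qed
  then show ?thesis by auto
qed

lemma eigenvalues_conj_transpose: "eigenvalues (conj_transpose M) = cnj ` eigenvalues M"
proof -
  have "det (conj_transpose N) = 0 \<longleftrightarrow> det N = 0" for N :: "complex^'n^'n"
  proof -
    have "det N \<noteq> 0 \<Longrightarrow> det (conj_transpose N) \<noteq> 0" for N :: "complex^'n^'n"
      using matrix_inv_cancel[of N] conj_transpose_mult
      by (metis invertible_det_nz invertible_left_inverse conj_transpose_mat complex_cnj_one)
    from this[of N] this[of "conj_transpose N"] show ?thesis by auto
  qed
  from this[of "mat (cnj _) - M"]
  have "det (mat z - conj_transpose M) = 0 \<longleftrightarrow> det (mat (cnj z) - M) = 0" for z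
    by (simp add: conj_transpose_diff)
  then show ?thesis
    by (auto simp: eigenvalues_eq_det image_cnj_conv_vimage_cnj)
qed

text \<open>Comparing both sides of \<open>M v = z v\<close> in a coordinate where \<open>v\<close> is largest in modulus.\<close>

lemma eigenvalue_norm_le:
  assumes "z \<in> eigenvalues M"
  shows "norm z \<le> (\<Sum>i\<in>UNIV. \<Sum>j\<in>UNIV. norm (M $ i $ j))"
proof -
  obtain v where v: "v \<noteq> 0" "M *v v = z *s v"
    using assms by (auto simp: eigenvalues_def)
  obtain k where k: "\<And>j. norm (v $ j) \<le> norm (v $ k)"
  proof -
    have "\<exists>k. norm (v $ k) = Max (range (\<lambda>j. norm (v $ j)))"
      by (metis (mono_tags, lifting) Max_in finite_code finite_imageI imageE UNIV_not_empty image_is_empty)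
    then show ?thesis
      by (metis that Max_ge finite_code finite_imageI rangeI)
  qed
  have pos: "norm (v $ k) > 0"
  proof (rule ccontr)
    assume "\<not> norm (v $ k) > 0"
    then have "v $ j = 0" for j
      using k[of j] by simp
    then show False
      using v(1) by (simp add: vec_eq_iff)
  qed
  have "norm z * norm (v $ k) = norm ((M *v v) $ k)"
    using v(2) by (simp add: norm_mult)
  also have "\<dots> \<le> (\<Sum>j\<in>UNIV. norm (M $ k $ j * v $ j))"
    by (simp add: matrix_vector_mult_def norm_sum)
  also have "\<dots> \<le> (\<Sum>j\<in>UNIV. norm (M $ k $ j) * norm (v $ k))"
    by (intro sum_mono) (simp add: norm_mult k mult_left_mono)
  also have "\<dots> = (\<Sum>j\<in>UNIV. norm (M $ k $ j)) * norm (v $ k)"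
    by (simp add: sum_distrib_right)
  finally have "norm z \<le> (\<Sum>j\<in>UNIV. norm (M $ k $ j))"
    using pos by simp
  also have "\<dots> \<le> (\<Sum>i\<in>UNIV. \<Sum>j\<in>UNIV. norm (M $ i $ j))"
    by (rule member_le_sum) (auto intro: sum_nonneg)
  finally show ?thesis .
qed

lemma continuous_on_mat_diff_nth:
  fixes B :: "'a::topological_space \<Rightarrow> complex^'n^'n"
  assumes "continuous_on T z" and "continuous_on T B"
  shows "continuous_on T (\<lambda>p. (mat (z p) - B p) $ i $ j)"
  using assms by (cases "i = j") (auto simp: mat_def intro!: continuous_intros continuous_on_component)

lemma holomorphic_on_mat_diff_nth: "(\<lambda>z. (mat z - M) $ i $ j) holomorphic_on T"
  by (cases "i = j") (auto simp: mat_def intro!: holomorphic_intros)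

text \<open>The zeros of the entire function \<open>det (z I - M)\<close> lie in a disc, so there are finitely many unless
  the function is constant.  A constant value would be nonzero, as it is nonzero outside the disc.\<close>

lemma finite_eigenvalues: "finite (eigenvalues (M :: complex^'n^'n))"
proof -
  define K where "K = (\<Sum>i\<in>UNIV. \<Sum>j\<in>UNIV. norm (M $ i $ j))"
  have K: "eigenvalues M \<subseteq> cball 0 K"
    using eigenvalue_norm_le by (auto simp: K_def)
  have hol: "(\<lambda>z. det (mat z - M)) holomorphic_on UNIV"
    by (intro holomorphic_on_det holomorphic_on_mat_diff_nth)
  have "finite (eigenvalues M)" if nc: "\<not> (\<lambda>z. det (mat z - M)) constant_on UNIV"
  proof -
    have "finite {z \<in> cball 0 K. det (mat z - M) = 0}"
      by (rule holomorphic_compact_finite_zeros[OF hol _ _ _ _ nc]) auto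
    then show ?thesis
      using K by (elim finite_subset[rotated]) (auto simp: eigenvalues_eq_det)
  qed
  moreover have "eigenvalues M = {}" if const: "(\<lambda>z. det (mat z - M)) constant_on UNIV"
  proof -
    obtain c where c: "\<forall>z. det (mat z - M) = c"
      using const unfolding constant_on_def by auto
    have "complex_of_real (\<bar>K\<bar> + 1) \<notin> eigenvalues M"
      using K by (auto simp: norm_of_real simp del: of_real_add)
    then have "c \<noteq> 0" using c by (cases "c = 0") (simp_all add: eigenvalues_eq_det)
    then show ?thesis using c by (simp add: eigenvalues_eq_det)
  qed
  ultimately show ?thesis by force
qed

lemma matrix_mult_diff_left: "M ** (N - P) = M ** N - M ** (P :: complex^'n^'n)"
  by (simp add: vec_eq_iff matrix_matrix_mult_def algebra_simps sum_subtractf)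

lemma matrix_mult_diff_right: "(M - N) ** P = M ** P - N ** (P :: complex^'n^'n)"
  by (simp add: vec_eq_iff matrix_matrix_mult_def algebra_simps sum_subtractf)

lemma resolvent_identity:
  fixes A B :: "complex^'n^'n"
  assumes "det (mat z - A) \<noteq> 0" "det (mat z - B) \<noteq> 0"
  shows "matrix_inv (mat z - B) - matrix_inv (mat z - A)
       = matrix_inv (mat z - A) ** (B - A) ** matrix_inv (mat z - B)"
proof -
  have "X ** (P - Q) ** Y = Y - X" if "X ** P = mat 1" "Q ** Y = mat 1"
    for X P Q Y :: "complex^'n^'n"
  proof -
    have "X ** (P - Q) ** Y = (X ** P) ** Y - X ** (Q ** Y)"
      by (simp only: matrix_mult_diff_left matrix_mult_diff_right matrix_mul_assoc)
    then show ?thesis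
      by (simp add: that)
  qed
  from this[OF matrix_inv_cancel(2)[OF assms(1)] matrix_inv_cancel(1)[OF assms(2)]]
  show ?thesis by simp
qed

text \<open>Eigenvalues of matrices near \<open>A\<close> stay in a fixed disc, so the pairs \<open>(B, z)\<close> with \<open>B\<close> close to \<open>A\<close>
  and \<open>z\<close> an eigenvalue of \<open>B\<close> outside \<open>U\<close> form a compact set.  Its projection to the matrices is
  closed and misses \<open>A\<close>.\<close>

lemma eventually_eigenvalues_subset:
  fixes A :: "complex^'n^'n"
  assumes "open U" "eigenvalues A \<subseteq> U"
  shows "\<forall>\<^sub>F B in nhds A. eigenvalues B \<subseteq> U"
proof -
  \<comment> \<open>this radius bounds the eigenvalues of every \<open>B\<close> whose entries differ from those of \<open>A\<close> by at most 1\<close>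
  define K where "K = (\<Sum>i\<in>UNIV. \<Sum>j\<in>UNIV. norm (A $ i $ j) + 1)"
  define T where "T = {p \<in> cball A 1 \<times> (cball 0 K - U). det (mat (snd p) - fst p) = 0}"
  have "continuous_on (cball A 1 \<times> (cball 0 K - U)) (\<lambda>p. det (mat (snd p) - fst p))"
    by (intro continuous_on_det continuous_on_mat_diff_nth continuous_intros)
  moreover have "compact (cball A 1 \<times> (cball 0 K - U))"
    using assms(1) by (intro compact_Times compact_diff) auto
  ultimately have "closed T"
    unfolding T_def by (intro continuous_closed_preimage_constant compact_imp_closed)
  with \<open>compact _\<close> have "compact ((cball A 1 \<times> (cball 0 K - U)) \<inter> T)"
    by (rule compact_Int_closed)
  also have "(cball A 1 \<times> (cball 0 K - U)) \<inter> T = T"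
    by (auto simp: T_def)
  finally have "compact T" .
  then have "closed (fst ` T)"
    by (intro compact_imp_closed compact_continuous_image) (auto intro!: continuous_intros)
  moreover have "A \<notin> fst ` T"
    using assms(2) by (auto simp: T_def eigenvalues_eq_det)
  ultimately have "\<forall>\<^sub>F B in nhds A. B \<in> - fst ` T"
    by (intro eventually_nhds_in_open) auto
  moreover have "\<forall>\<^sub>F B in nhds A. B \<in> ball A 1"
    by (intro eventually_nhds_in_open) auto
  ultimately show ?thesis
  proof eventually_elim
    case (elim B)
    show ?case
    proof
      fix z assume z: "z \<in> eigenvalues B"
      have "norm (B $ i $ j) \<le> norm (A $ i $ j) + 1" for i j
      proof -
        have "norm ((B - A) $ i $ j) \<le> norm (B - A)"
          by (meson Finite_Cartesian_Product.norm_nth_le order_trans)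
        also have "\<dots> \<le> 1"
          using elim(2) by (simp add: dist_norm norm_minus_commute)
        finally show ?thesis
          using norm_triangle_sub[of "B $ i $ j" "A $ i $ j"] by simp
      qed
      then have "norm z \<le> K"
        unfolding K_def by (intro order_trans[OF eigenvalue_norm_le[OF z]] sum_mono)
      then have "z \<notin> U \<Longrightarrow> (B, z) \<in> T"
        using elim(2) z by (auto simp: T_def eigenvalues_eq_det)
      then show "z \<in> U"
        using elim(1) by force
    qed
  qed
qed

section \<open>Integration over a cycle of small circles\<close>

text \<open>The factor 2 leaves a margin around each circle of radius \<open>r\<close>: the residue theorem needs a
  neighbourhood of the closed disc that meets no other disc.\<close>

definition separated_discs :: "complex set \<Rightarrow> real \<Rightarrow> complex set \<Rightarrow> bool" where
  "separated_discs W r S \<longleftrightarrow> finite W \<and> r > 0 \<and> (\<forall>w\<in>W. ball w (2 * r) \<subseteq> S) \<and>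
     (\<forall>v\<in>W. \<forall>w\<in>W. v \<noteq> w \<longrightarrow> ball v (2 * r) \<inter> ball w (2 * r) = {})"

text \<open>The Cauchy integral over the cycle of circles of radius \<open>r\<close> about the points of \<open>W\<close>, normalised by
  \<open>1/(2\<pi>\<i>)\<close>.  The cycle does not depend on the matrix, whereas the circles in \<^const>\<open>matrix_fun\<close>
  move with the eigenvalues; a fixed cycle is what allows differentiation under the integral.\<close>

definition circle_sum :: "complex set \<Rightarrow> real \<Rightarrow> (complex \<Rightarrow> complex) \<Rightarrow> complex" where
  "circle_sum W r g = (\<Sum>w\<in>W. contour_integral (circlepath w r) g) / (2 * pi * \<i>)"

lemma separated_discs_exist:
  assumes "finite W" "open S" "W \<subseteq> S"
  obtains r where "separated_discs W r S"
proof -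
  have "\<forall>\<^sub>F r in at_right 0. ball w (2 * r) \<subseteq> S" if "w \<in> W" for w
  proof -
    obtain e where e: "e > 0" "ball w e \<subseteq> S"
      using assms \<open>w \<in> W\<close> by (meson openE subsetD)
    have "\<forall>\<^sub>F r in at_right 0. r \<in> {0<..<e / 2}"
      using e by (intro eventually_at_right_real) auto
    then show ?thesis
      by eventually_elim (use e in \<open>auto intro!: order_trans[OF subset_ball]\<close>)
  qed
  then have 1: "\<forall>\<^sub>F r in at_right 0. \<forall>w\<in>W. ball w (2 * r) \<subseteq> S"
    using assms by (intro eventually_ball_finite) auto
  have "\<forall>\<^sub>F r in at_right 0. v \<noteq> w \<longrightarrow> ball v (2 * r) \<inter> ball w (2 * r) = {}" for v w :: complex
  proof (cases "v = w")
    case False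
    then have "\<forall>\<^sub>F r in at_right 0. r \<in> {0<..<dist v w / 4}"
      by (intro eventually_at_right_real) auto
    then show ?thesis
      by eventually_elim (auto intro!: disjoint_ballI)
  qed auto
  then have 2: "\<forall>\<^sub>F r in at_right 0. \<forall>v\<in>W. \<forall>w\<in>W. v \<noteq> w \<longrightarrow> ball v (2 * r) \<inter> ball w (2 * r) = {}"
    using assms by (intro eventually_ball_finite ballI) auto
  have 3: "\<forall>\<^sub>F r in at_right 0. r > (0::real)"
    by (simp add: eventually_at_right_less)
  from 1 2 3 have "\<forall>\<^sub>F r in at_right 0. separated_discs W r S"
    by eventually_elim (use assms in \<open>auto simp: separated_discs_def\<close>)
  then show thesis
    using that eventually_happens' trivial_limit_at_right_real by blast
qed

lemma sphere_not_in_separated_disc: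
  assumes "separated_discs W r S" "v \<in> W" "w \<in> W" "z \<in> sphere v r"
  shows "z \<notin> ball w r"
proof
  assume z: "z \<in> ball w r"
  have r: "r > 0" and "v \<noteq> w \<longrightarrow> ball v (2 * r) \<inter> ball w (2 * r) = {}"
    using assms by (auto simp: separated_discs_def)
  moreover have "z \<in> ball v (2 * r) \<inter> ball w (2 * r)"
    using z r assms(4) by auto
  ultimately have "v = w" by blast
  then show False using z assms(4) by auto
qed

lemma sphere_subset_domain:
  assumes "separated_discs W r S" "w \<in> W" "z \<in> sphere w r"
  shows "z \<in> S"
proof -
  have "r > 0" "ball w (2 * r) \<subseteq> S"
    using assms by (auto simp: separated_discs_def)
  moreover have "z \<in> ball w (2 * r)"
    using \<open>r > 0\<close> assms(3) by auto
  ultimately show ?thesis by blast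
qed

lemma circle_sum_cong:
  assumes "r > 0" "\<And>z. z \<in> (\<Union>w\<in>W. sphere w r) \<Longrightarrow> g z = h z"
  shows "circle_sum W r g = circle_sum W r h"
proof -
  have "contour_integral (circlepath w r) g = contour_integral (circlepath w r) h" if "w \<in> W" for w
    by (rule contour_integral_cong) (use that assms in \<open>auto simp: path_image_circlepath\<close>)
  then show ?thesis
    by (simp add: circle_sum_def)
qed

lemma contour_integrable_on_circle:
  assumes "r > 0" "continuous_on (\<Union>w\<in>W. sphere w r) g" "w \<in> W"
  shows "g contour_integrable_on circlepath w r"
  by (rule contour_integrable_continuous_circlepath)
    (use assms in \<open>auto intro: continuous_on_subset\<close>)

lemma circle_sum_sum:
  assumes "r > 0" "finite I" "\<And>i. i \<in> I \<Longrightarrow> continuous_on (\<Union>w\<in>W. sphere w r) (g i)"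
  shows "circle_sum W r (\<lambda>z. \<Sum>i\<in>I. g i z) = (\<Sum>i\<in>I. circle_sum W r (g i))"
proof -
  have "contour_integral (circlepath w r) (\<lambda>z. \<Sum>i\<in>I. g i z)
      = (\<Sum>i\<in>I. contour_integral (circlepath w r) (g i))" if "w \<in> W" for w
    by (intro contour_integral_sum assms contour_integrable_on_circle[OF assms(1) _ that])
  then show ?thesis
    by (simp add: circle_sum_def sum_divide_distrib) (rule sum.swap)
qed

lemma circle_sum_lmul:
  assumes "r > 0" "continuous_on (\<Union>w\<in>W. sphere w r) g"
  shows "circle_sum W r (\<lambda>z. c * g z) = c * circle_sum W r g"
proof -
  have "contour_integral (circlepath w r) (\<lambda>z. c * g z) = c * contour_integral (circlepath w r) g"
    if "w \<in> W" for w
    by (intro contour_integral_lmul contour_integrable_on_circle[OF assms that])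
  then show ?thesis
    by (simp add: circle_sum_def sum_distrib_left)
qed

lemma circle_sum_diff:
  assumes "r > 0" "continuous_on (\<Union>w\<in>W. sphere w r) g" "continuous_on (\<Union>w\<in>W. sphere w r) h"
  shows "circle_sum W r (\<lambda>z. g z - h z) = circle_sum W r g - circle_sum W r h"
proof -
  have "contour_integral (circlepath w r) (\<lambda>z. g z - h z)
      = contour_integral (circlepath w r) g - contour_integral (circlepath w r) h"
    if "w \<in> W" for w
    using assms by (intro contour_integral_diff contour_integrable_on_circle[OF _ _ that])
  then show ?thesis
    by (simp add: circle_sum_def sum_subtractf diff_divide_distrib)
qed

lemma continuous_on_circle_sum:
  assumes "r > 0" "continuous_on (T \<times> (\<Union>w\<in>W. sphere w r)) (\<lambda>(x, z). g x z)"
  shows "continuous_on T (\<lambda>x. circle_sum W r (g x))"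
proof -
  have "continuous_on T (\<lambda>x. contour_integral (circlepath w r) (g x))" if "w \<in> W" for w
  proof -
    have "continuous_on (T \<times> cbox 0 1) (\<lambda>p. (fst p, circlepath w r (snd p)))"
      unfolding circlepath by (intro continuous_intros)
    then have "continuous_on (T \<times> cbox 0 1) (\<lambda>p. (\<lambda>(x, z). g x z) (fst p, circlepath w r (snd p)))"
      by (rule continuous_on_compose2[OF assms(2)])
        (use that assms(1) in \<open>auto simp: circlepath dist_norm norm_mult intro!: bexI[of _ w]\<close>)
    then have "continuous_on (T \<times> cbox 0 1) (\<lambda>(x, t). g x (circlepath w r t)
        * vector_derivative (circlepath w r) (at t))"
      unfolding vector_derivative_circlepath case_prod_unfold
      by (intro continuous_intros) auto
    from integral_continuous_on_param[OF this] show ?thesis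
      by (simp add: contour_integral_integral)
  qed
  then show ?thesis
    unfolding circle_sum_def by (intro continuous_intros) auto
qed

text \<open>The poles may lie anywhere in the discs, and several of them may share a disc: this is what
  happens when a multiple eigenvalue splits under a perturbation.\<close>

lemma sum_residue_eq_circle_sum:
  assumes discs: "separated_discs W r S" and "finite P" "P \<subseteq> (\<Union>w\<in>W. ball w r)"
    and hol: "g holomorphic_on S - P"
  shows "(\<Sum>p\<in>P. residue g p) = circle_sum W r g"
proof -
  have r: "r > 0" and W: "finite W" "\<And>w. w \<in> W \<Longrightarrow> ball w (2 * r) \<subseteq> S"
    "\<And>v w. v \<in> W \<Longrightarrow> w \<in> W \<Longrightarrow> v \<noteq> w \<Longrightarrow> ball v (2 * r) \<inter> ball w (2 * r) = {}"
    using discs by (auto simp: separated_discs_def)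
  have ball_mono: "ball w r \<subseteq> ball w (2 * r)" for w :: complex
    using r by (intro subset_ball) simp
  have inside: "P \<inter> ball w (2 * r) = P \<inter> ball w r" if "w \<in> W" for w
    using assms(3) W(3)[OF that] ball_mono by blast
  have "contour_integral (circlepath w r) g = 2 * pi * \<i> * (\<Sum>p\<in>P \<inter> ball w r. residue g p)"
    if w: "w \<in> W" for w
  proof -
    have "contour_integral (circlepath w r) g
        = 2 * pi * \<i> * (\<Sum>p\<in>P \<inter> ball w r. winding_number (circlepath w r) p * residue g p)"
    proof (rule Residue_theorem[of "ball w (2 * r)"])
      show "g holomorphic_on ball w (2 * r) - (P \<inter> ball w r)"
        by (rule holomorphic_on_subset[OF hol]) (use W(2)[OF w] inside[OF w] in blast)
      show "path_image (circlepath w r) \<subseteq> ball w (2 * r) - P \<inter> ball w r"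
        using r by (auto simp: path_image_circlepath)
      show "\<forall>z. z \<notin> ball w (2 * r) \<longrightarrow> winding_number (circlepath w r) z = 0"
        using r by (auto intro!: winding_number_zero_outside[of _ "cball w r"])
    qed (use assms(2) in auto)
    also have "(\<Sum>p\<in>P \<inter> ball w r. winding_number (circlepath w r) p * residue g p)
        = (\<Sum>p\<in>P \<inter> ball w r. residue g p)"
      by (rule sum.cong) (auto simp: winding_number_circlepath dist_norm norm_minus_commute)
    finally show ?thesis .
  qed
  then have "circle_sum W r g = (\<Sum>w\<in>W. \<Sum>p\<in>P \<inter> ball w r. residue g p)"
    by (simp add: circle_sum_def sum_distrib_left[symmetric])
  also have "\<dots> = (\<Sum>p\<in>(\<Union>w\<in>W. P \<inter> ball w r). residue g p)"
    using W assms(2) ball_mono by (intro sum.UNION_disjoint[symmetric]) blast+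
  also have "(\<Union>w\<in>W. P \<inter> ball w r) = P"
    using assms(3) by blast
  finally show ?thesis ..
qed

section \<open>Symmetry of the derivative under the trace form\<close>

lemma trace_matrix_mult: "trace (M ** N) = (\<Sum>i\<in>UNIV. \<Sum>j\<in>UNIV. M $ i $ j * N $ j $ i)"
  by (simp add: trace_def matrix_matrix_mult_def)

text \<open>Cauchy's formula for \<open>f(B)\<close> over circles whose centres need not be eigenvalues of \<open>B\<close>.  Pairing with \<open>X\<close> under
  the trace makes all integrals scalar and encodes all entries at once.\<close>

lemma trace_matrix_fun:
  fixes B X :: "complex^'n^'n"
  assumes discs: "separated_discs W r S" and hol: "f holomorphic_on S"
    and eig: "eigenvalues B \<subseteq> (\<Union>w\<in>W. ball w r)"
  shows "trace (matrix_fun f B ** X)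
       = circle_sum W r (\<lambda>z. f z * trace (matrix_inv (mat z - B) ** X))"
proof -
  have r: "r > 0" using discs by (simp add: separated_discs_def)
  have hol': "(\<lambda>z. f z * matrix_inv (mat z - B) $ i $ j) holomorphic_on S - eigenvalues B" for i j
    by (intro holomorphic_intros holomorphic_on_matrix_inv_nth holomorphic_on_mat_diff_nth
        holomorphic_on_subset[OF hol]) (auto simp: eigenvalues_eq_det)
  have "(\<Union>w\<in>W. sphere w r) \<subseteq> S - eigenvalues B"
    using sphere_not_in_separated_disc[OF discs] sphere_subset_domain[OF discs] eig by blast
  then have cont: "continuous_on (\<Union>w\<in>W. sphere w r) (\<lambda>z. f z * matrix_inv (mat z - B) $ i $ j)" for i j
    using hol' holomorphic_on_imp_continuous_on continuous_on_subset by blast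
  have "matrix_fun f B $ i $ j = circle_sum W r (\<lambda>z. f z * matrix_inv (mat z - B) $ i $ j)" for i j
    using sum_residue_eq_circle_sum[OF discs finite_eigenvalues eig hol'] by (simp add: matrix_fun_def)
  then have "trace (matrix_fun f B ** X)
      = (\<Sum>i\<in>UNIV. \<Sum>j\<in>UNIV. circle_sum W r (\<lambda>z. X $ j $ i * (f z * matrix_inv (mat z - B) $ i $ j)))"
    unfolding trace_matrix_mult by (simp add: circle_sum_lmul[OF r cont] mult.commute)
  also have "\<dots> = circle_sum W r
      (\<lambda>z. \<Sum>i\<in>UNIV. \<Sum>j\<in>UNIV. X $ j $ i * (f z * matrix_inv (mat z - B) $ i $ j))"
    by (simp add: circle_sum_sum[OF r] cont continuous_intros)
  also have "\<dots> = circle_sum W r (\<lambda>z. f z * trace (matrix_inv (mat z - B) ** X))"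
    by (simp add: trace_matrix_mult sum_distrib_left mult_ac)
  finally show ?thesis .
qed

lemma continuous_on_matrix_mult_nth:
  fixes M N :: "'a::topological_space \<Rightarrow> complex^'n^'n"
  assumes "\<And>i j. continuous_on T (\<lambda>x. M x $ i $ j)" "\<And>i j. continuous_on T (\<lambda>x. N x $ i $ j)"
  shows "continuous_on T (\<lambda>x. (M x ** N x) $ i $ j)"
  unfolding matrix_matrix_mult_def by (simp add: assms continuous_intros)

lemma continuous_on_trace:
  fixes M :: "'a::topological_space \<Rightarrow> complex^'n^'n"
  assumes "\<And>i j. continuous_on T (\<lambda>x. M x $ i $ j)"
  shows "continuous_on T (\<lambda>x. trace (M x))"
  unfolding trace_def by (intro assms continuous_intros)

lemma trace_scaleR_matrix: "trace (a *\<^sub>R M) = of_real a * trace (M :: complex^'n^'n)"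
  by (simp only: trace_def vector_scaleR_component)
    (simp only: scaleR_conv_of_real sum_distrib_left)

text \<open>By the resolvent identity the difference quotient is the integral of \<open>f(z)\<close> times the trace of
  \<open>(z I - A)\<^sup>-\<^sup>1 E (z I - A - \<epsilon>E)\<^sup>-\<^sup>1 X\<close>, an expression free of division by \<open>\<epsilon>\<close>.  As a function of the
  perturbed matrix this integral is continuous near \<open>A\<close>, so its limit is its value at \<open>A\<close>.\<close>

lemma matrix_fun_difference_quotient_tendsto:
  fixes A E X :: "complex^'n^'n"
  assumes discs: "separated_discs W r S" and hol: "f holomorphic_on S"
    and eig: "eigenvalues A \<subseteq> (\<Union>w\<in>W. ball w r)"
  defines "R \<equiv> \<lambda>z. matrix_inv (mat z - A)"
  shows "((\<lambda>\<epsilon>. trace ((matrix_fun f (A + \<epsilon> *\<^sub>R E) - matrix_fun f A) ** X) / of_real \<epsilon>)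
      \<longlongrightarrow> circle_sum W r (\<lambda>z. f z * trace (R z ** E ** R z ** X))) (at_right 0)"
proof -
  define Z where "Z = (\<Union>w\<in>W. sphere w r)"
  define G where "G = (\<lambda>B. circle_sum W r
      (\<lambda>z. f z * trace (R z ** E ** matrix_inv (mat z - B) ** X)))"
  have r: "r > 0" using discs by (simp add: separated_discs_def)
  have "\<forall>\<^sub>F B in nhds A. eigenvalues B \<subseteq> (\<Union>w\<in>W. ball w r)"
    using eig by (intro eventually_eigenvalues_subset) auto
  then obtain T where T: "open T" "A \<in> T" "\<And>B. B \<in> T \<Longrightarrow> eigenvalues B \<subseteq> (\<Union>w\<in>W. ball w r)"
    unfolding eventually_nhds by blast
  have Z: "z \<in> S" "det (mat z - B) \<noteq> 0" if "z \<in> Z" "B \<in> T" for z B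
  proof -
    obtain w where w: "w \<in> W" "z \<in> sphere w r"
      using \<open>z \<in> Z\<close> by (auto simp: Z_def)
    then show "z \<in> S"
      using sphere_subset_domain[OF discs] by blast
    show "det (mat z - B) \<noteq> 0"
      using sphere_not_in_separated_disc[OF discs w(1) _ w(2)] T(3)[OF that(2)]
      by (auto simp: eigenvalues_eq_det)
  qed
  have cont_f: "continuous_on Z f"
    using hol Z(1) T(2) by (meson holomorphic_on_imp_continuous_on continuous_on_subset subsetI)
  have cont_inv: "continuous_on Z (\<lambda>z. matrix_inv (mat z - B) $ i $ j)" if "B \<in> T" for B i j
    by (intro continuous_on_matrix_inv_nth continuous_on_mat_diff_nth continuous_intros Z that)
  have "continuous_on (T \<times> Z) (\<lambda>p. f (snd p) * 
      trace (R (snd p) ** E ** matrix_inv (mat (snd p) - fst p) ** X))"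
    unfolding R_def
    by (intro continuous_intros continuous_on_trace continuous_on_matrix_mult_nth
        continuous_on_matrix_inv_nth continuous_on_mat_diff_nth continuous_on_compose2[OF cont_f])
      (use Z T(2) in auto)
  then have "continuous_on T G"
    unfolding G_def by (intro continuous_on_circle_sum r) (simp add: Z_def case_prod_unfold)
  then have "isCont G A"
    using T by (simp add: continuous_on_eq_continuous_at)
  moreover have lim: "((\<lambda>\<epsilon>. A + \<epsilon> *\<^sub>R E) \<longlongrightarrow> A) (at_right 0)"
    by (auto intro!: tendsto_eq_intros)
  ultimately have "((\<lambda>\<epsilon>. G (A + \<epsilon> *\<^sub>R E)) \<longlongrightarrow> G A) (at_right 0)"
    by (rule isCont_tendsto_compose)
  moreover have "\<forall>\<^sub>F \<epsilon> in at_right 0. G (A + \<epsilon> *\<^sub>R E)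
      = trace ((matrix_fun f (A + \<epsilon> *\<^sub>R E) - matrix_fun f A) ** X) / of_real \<epsilon>"
  proof -
    have "\<forall>\<^sub>F \<epsilon> in at_right 0. A + \<epsilon> *\<^sub>R E \<in> T"
      by (rule topological_tendstoD[OF lim T(1,2)])
    moreover have "\<forall>\<^sub>F \<epsilon> in at_right 0. \<epsilon> > (0::real)"
      by (simp add: eventually_at_right_less)
    ultimately show ?thesis
    proof eventually_elim
      case (elim \<epsilon>)
      let ?B = "A + \<epsilon> *\<^sub>R E"
      have cont: "continuous_on Z (\<lambda>z. f z * trace (matrix_inv (mat z - B) ** X))" if "B \<in> T" for B
        by (intro continuous_intros continuous_on_trace continuous_on_matrix_mult_nth cont_f cont_inv that)
      have "trace ((matrix_fun f ?B - matrix_fun f A) ** X)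
          = trace (matrix_fun f ?B ** X) - trace (matrix_fun f A ** X)"
        by (simp add: matrix_mult_diff_right trace_sub)
      also have "\<dots> = circle_sum W r (\<lambda>z. f z * trace (matrix_inv (mat z - ?B) ** X)
          - f z * trace (R z ** X))"
        unfolding R_def using cont[OF elim(1)] cont[OF T(2)]
        by (subst circle_sum_diff[OF r])
          (simp_all add: Z_def trace_matrix_fun[OF discs hol] T(3)[OF elim(1)] T(3)[OF T(2)])
      also have "\<dots> = circle_sum W r
          (\<lambda>z. of_real \<epsilon> * (f z * trace (R z ** E ** matrix_inv (mat z - ?B) ** X)))"
      proof (rule circle_sum_cong[OF r], fold Z_def)
        fix z assume z: "z \<in> Z"
        have scale: "M ** (\<epsilon> *\<^sub>R E) ** N ** X = \<epsilon> *\<^sub>R (M ** E ** N ** X)" for M N :: "complex^'n^'n"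
          by (simp add: matrix_scalar_ac scalar_matrix_assoc[symmetric])
        have "matrix_inv (mat z - ?B) - R z = R z ** (\<epsilon> *\<^sub>R E) ** matrix_inv (mat z - ?B)"
          using resolvent_identity[OF Z(2)[OF z T(2)] Z(2)[OF z elim(1)]] by (simp add: R_def)
        then have "(matrix_inv (mat z - ?B) - R z) ** X
            = \<epsilon> *\<^sub>R (R z ** E ** matrix_inv (mat z - ?B) ** X)"
          by (simp only: scale)
        then have "trace (matrix_inv (mat z - ?B) ** X) - trace (R z ** X)
            = of_real \<epsilon> * trace (R z ** E ** matrix_inv (mat z - ?B) ** X)"
          by (metis matrix_mult_diff_right trace_sub trace_scaleR_matrix)
        then show "f z * trace (matrix_inv (mat z - ?B) ** X) - f z * trace (R z ** X)
            = of_real \<epsilon> * (f z * trace (R z ** E ** matrix_inv (mat z - ?B) ** X))"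
          by (metis mult.left_commute right_diff_distrib)
      qed
      also have "\<dots> = of_real \<epsilon> * G ?B"
        unfolding G_def
      proof (intro circle_sum_lmul r, fold Z_def)
        show "continuous_on Z (\<lambda>z. f z * trace (R z ** E ** matrix_inv (mat z - ?B) ** X))"
          unfolding R_def
          by (intro continuous_intros continuous_on_trace continuous_on_matrix_mult_nth
              cont_f cont_inv elim(1) T(2))
      qed
      finally show ?case
        using elim(2) by simp
    qed
  qed
  ultimately show ?thesis
    unfolding G_def R_def by (rule Lim_transform_eventually)
qed

lemma frechet_deriv_difference_quotient_tendsto:
  assumes "is_frechet_deriv f A L"
  shows "((\<lambda>\<epsilon>. trace ((matrix_fun f (A + \<epsilon> *\<^sub>R E) - matrix_fun f A) ** X) / of_real \<epsilon>)
      \<longlongrightarrow> trace (L E ** X)) (at_right 0)"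
proof -
  define D where "D = (\<lambda>\<epsilon>::real. matrix_fun f (A + \<epsilon> *\<^sub>R E) - matrix_fun f A - \<epsilon> *\<^sub>R L E)"
  have "(\<lambda>\<epsilon>. norm (D \<epsilon>)) \<in> O[at_right 0](\<lambda>\<epsilon>. \<epsilon>\<^sup>2)"
    using assms unfolding is_frechet_deriv_def D_def by blast
  then obtain c where "\<forall>\<^sub>F \<epsilon> in at_right 0. norm (norm (D \<epsilon>)) \<le> c * norm (\<epsilon>\<^sup>2)"
    by (auto elim!: landau_o.bigE)
  moreover have pos: "\<forall>\<^sub>F \<epsilon> in at_right 0. \<epsilon> > (0::real)"
    by (simp add: eventually_at_right_less)
  ultimately have "\<forall>\<^sub>F \<epsilon> in at_right 0. norm ((1 / \<epsilon>) *\<^sub>R D \<epsilon>) \<le> c * \<epsilon>"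
    by eventually_elim (simp add: field_simps power2_eq_square)
  moreover have "((\<lambda>\<epsilon>::real. c * \<epsilon>) \<longlongrightarrow> 0) (at_right 0)"
    by (auto intro!: tendsto_eq_intros)
  ultimately have D: "((\<lambda>\<epsilon>. (1 / \<epsilon>) *\<^sub>R D \<epsilon>) \<longlongrightarrow> 0) (at_right 0)"
    by (rule Lim_null_comparison)
  have "((\<lambda>\<epsilon>. trace (((1 / \<epsilon>) *\<^sub>R D \<epsilon> + L E) ** X)) \<longlongrightarrow> trace ((0 + L E) ** X)) (at_right 0)"
    unfolding trace_matrix_mult by (intro tendsto_intros D)
  moreover have "\<forall>\<^sub>F \<epsilon> in at_right 0. trace (((1 / \<epsilon>) *\<^sub>R D \<epsilon> + L E) ** X)
      = trace ((matrix_fun f (A + \<epsilon> *\<^sub>R E) - matrix_fun f A) ** X) / of_real \<epsilon>"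
    using pos
  proof eventually_elim
    case (elim \<epsilon>)
    have "(1 / \<epsilon>) *\<^sub>R D \<epsilon> + L E = (1 / \<epsilon>) *\<^sub>R (matrix_fun f (A + \<epsilon> *\<^sub>R E) - matrix_fun f A)"
      using elim by (simp add: D_def scaleR_diff_right)
    then show ?case
      by (simp add: scalar_matrix_assoc[symmetric] trace_scaleR_matrix)
  qed
  ultimately show ?thesis
    by (simp add: Lim_transform_eventually)
qed

text \<open>In \<open>tr(L(E) X) = 1/(2\<pi>\<i>) \<integral> f(z) tr(R(z) E R(z) X) dz\<close>, with the resolvent
  \<open>R(z) = (z I - A)\<^sup>-\<^sup>1\<close>, a cyclic shift under the trace exchanges \<open>E\<close> and \<open>X\<close>.  So \<open>L\<close> is its own
  transpose for the bilinear form \<open>tr(XY)\<close>.\<close>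

lemma frechet_deriv_trace_symmetric:
  assumes "open S" "f holomorphic_on S" "eigenvalues A \<subseteq> S" and L: "is_frechet_deriv f A L"
  shows "trace (L E ** X) = trace (E ** L X)"
proof -
  obtain r where discs: "separated_discs (eigenvalues A) r S"
    using separated_discs_exist[OF finite_eigenvalues assms(1,3)] .
  then have eig: "eigenvalues A \<subseteq> (\<Union>w\<in>eigenvalues A. ball w r)"
    by (force simp: separated_discs_def)
  let ?R = "\<lambda>z. matrix_inv (mat z - A)"
  have formula: "trace (L E ** X)
      = circle_sum (eigenvalues A) r (\<lambda>z. f z * trace (?R z ** E ** ?R z ** X))" for E X
    using frechet_deriv_difference_quotient_tendsto[OF L]
      matrix_fun_difference_quotient_tendsto[OF discs assms(2) eig]
    by (rule tendsto_unique[OF trivial_limit_at_right_real])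
  have "trace (?R z ** E ** ?R z ** X) = trace (?R z ** X ** ?R z ** E)" for z
    by (metis matrix_mul_assoc trace_mul_sym)
  then have "trace (L E ** X) = trace (L X ** E)"
    by (simp add: formula)
  then show ?thesis
    by (simp add: trace_mul_sym[of E])
qed

section \<open>The derivative at the conjugate transpose\<close>

text \<open>Conjugation maps the circle about \<open>w\<close> to the circle about \<open>cnj w\<close> run backwards.  The sign that
  this produces cancels against the one from conjugating the factor \<open>2\<pi>\<i>\<close>.\<close>

lemma residue_cnj:
  assumes s: "open s" "w \<in> s" and hol: "g holomorphic_on s - {w}"
  shows "residue (\<lambda>z. cnj (g (cnj z))) (cnj w) = cnj (residue g w)"
proof -
  let ?h = "\<lambda>z. cnj (g (cnj z))"
  obtain r where r: "r > 0" "cball w r \<subseteq> s"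
    using s open_contains_cball by blast
  have img: "cnj ` (cnj -` s - {cnj w}) \<subseteq> s - {w}"
    by (auto dest: arg_cong[of _ "cnj w" cnj])
  have "?h holomorphic_on cnj -` s - {cnj w}"
  proof -
    have "cnj \<circ> g \<circ> cnj holomorphic_on cnj -` s - {cnj w}"
      using img s by (intro holomorphic_on_compose_cnj_cnj holomorphic_on_subset[OF hol] open_Diff
          open_vimage) (auto intro!: continuous_intros)
    then show ?thesis by (simp add: o_def)
  qed
  moreover have "cball (cnj w) r \<subseteq> cnj -` s"
  proof
    fix z assume "z \<in> cball (cnj w) r"
    then have "cnj z \<in> cball w r"
      by (metis complex_cnj_cnj complex_cnj_diff complex_mod_cnj dist_norm mem_cball)
    then show "z \<in> cnj -` s"
      using r by auto
  qed
  moreover have "open (cnj -` s)"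
    using s by (intro open_vimage continuous_intros)
  ultimately have "(?h has_contour_integral 2 * pi * \<i> * residue ?h (cnj w)) (circlepath (cnj w) r)"
    using s r by (intro base_residue) auto
  then have 1: "contour_integral (circlepath (cnj w) r) ?h = 2 * pi * \<i> * residue ?h (cnj w)"
    by (rule contour_integral_unique)
  have 2: "contour_integral (circlepath w r) g = 2 * pi * \<i> * residue g w"
    using base_residue[OF s r(1) hol r(2)] by (rule contour_integral_unique)
  \<comment> \<open>by periodicity, angles from \<open>0\<close> down to \<open>-2\<pi>\<close> give the same path as angles from \<open>2\<pi>\<close> down to \<open>0\<close>\<close>
  have path: "cnj \<circ> circlepath w r = reversepath (circlepath (cnj w) r)"
  proof
    fix t
    have "part_circlepath (cnj w) r 0 (- (2 * pi)) t = part_circlepath (cnj w) r (2 * pi) 0 t"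
    proof -
      have "exp (\<i> * of_real (- (2 * pi) * t)) = exp (\<i> * of_real (2 * pi * (1 - t)))"
        using exp_two_pi_i by (simp add: algebra_simps exp_diff exp_minus)
          (simp add: field_simps)
      then show ?thesis
        by (simp add: part_circlepath_def linepath_def algebra_simps)
    qed
    then show "(cnj \<circ> circlepath w r) t = reversepath (circlepath (cnj w) r) t"
      by (simp add: circlepath_def part_circlepath_cnj)
  qed
  have "contour_integral (cnj \<circ> circlepath w r) ?h = - contour_integral (circlepath (cnj w) r) ?h"
    unfolding path by (rule contour_integral_reversepath) simp
  moreover have "contour_integral (cnj \<circ> circlepath w r) ?h = cnj (contour_integral (circlepath w r) g)"
    by (subst contour_integral_cnj) (simp_all add: o_def)
  ultimately have "cnj (2 * pi * \<i> * residue g w) = - (2 * pi * \<i> * residue ?h (cnj w))"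
    using 1 2 by simp
  then show ?thesis by simp
qed

text \<open>The resolvent of \<open>B\<^sup>*\<close> at \<open>cnj z\<close> is the adjoint of the resolvent of \<open>B\<close> at \<open>z\<close>, so the residues that
  define \<open>f(B\<^sup>*)\<close> are the conjugates of those that define \<open>f(B)\<close>.\<close>

lemma matrix_fun_conj_transpose:
  fixes B :: "complex^'n^'n"
  assumes S: "open S" and hol: "f holomorphic_on S" and eig: "eigenvalues B \<subseteq> S"
    and sym: "\<And>z. z \<in> S \<Longrightarrow> f (cnj z) = cnj (f z)"
  shows "matrix_fun f (conj_transpose B) = conj_transpose (matrix_fun f B)"
proof -
  have res: "residue (\<lambda>z. f z * matrix_inv (mat z - conj_transpose B) $ i $ j) (cnj w)
      = cnj (residue (\<lambda>z. f z * matrix_inv (mat z - B) $ j $ i) w)"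
    if w: "w \<in> eigenvalues B" for i j w
  proof -
    \<comment> \<open>\<open>w\<close> is the only singularity in \<open>s\<close>, as the residue at \<open>w\<close> requires\<close>
    define s where "s = S - (eigenvalues B - {w})"
    have s: "open s" "w \<in> s"
      using S eig w finite_eigenvalues[of B] by (auto simp: s_def intro!: open_Diff finite_imp_closed)
    have "(\<lambda>z. f z * matrix_inv (mat z - B) $ j $ i) holomorphic_on s - {w}"
      by (intro holomorphic_intros holomorphic_on_matrix_inv_nth holomorphic_on_mat_diff_nth
        holomorphic_on_subset[OF hol]) (auto simp: s_def eigenvalues_eq_det)
    from residue_cnj[OF s this]
    have base: "residue (\<lambda>z. cnj (f (cnj z) * matrix_inv (mat (cnj z) - B) $ j $ i)) (cnj w)
        = cnj (residue (\<lambda>z. f z * matrix_inv (mat z - B) $ j $ i) w)" .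
    have ev: "\<forall>\<^sub>F z in at (cnj w). f z * matrix_inv (mat z - conj_transpose B) $ i $ j
        = cnj (f (cnj z) * matrix_inv (mat (cnj z) - B) $ j $ i)"
    proof -
      have "\<forall>\<^sub>F z in at (cnj w). z \<in> cnj -` s - {cnj w}"
        using s by (intro eventually_at_in_open open_vimage continuous_intros) auto
      then show ?thesis
      proof eventually_elim
        case (elim z)
        then have z: "cnj z \<in> S" "cnj z \<notin> eigenvalues B"
          by (auto simp: s_def dest: arg_cong[of _ w cnj])
        have "mat z - conj_transpose B = conj_transpose (mat (cnj z) - B)"
          by (simp add: conj_transpose_diff)
        then have "matrix_inv (mat z - conj_transpose B) = conj_transpose (matrix_inv (mat (cnj z) - B))"
          using z(2) by (simp add: matrix_inv_conj_transpose eigenvalues_eq_det)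
        then show ?case
          using sym[OF z(1)] by simp
      qed
    qed
    show ?thesis
      by (rule trans[OF residue_cong[OF ev refl] base])
  qed
  have "(\<Sum>w\<in>eigenvalues (conj_transpose B).
           residue (\<lambda>z. f z * matrix_inv (mat z - conj_transpose B) $ i $ j) w)
      = (\<Sum>w\<in>eigenvalues B. cnj (residue (\<lambda>z. f z * matrix_inv (mat z - B) $ j $ i) w))" for i j
    unfolding eigenvalues_conj_transpose
    by (subst sum.reindex) (auto simp: inj_on_def res)
  then show ?thesis
    by (simp add: vec_eq_iff matrix_fun_def)
qed

text \<open>The identity \<open>f(B\<^sup>*) = f(B)\<^sup>*\<close> holds for all \<open>B\<close> near \<open>A\<close>, so it can be differentiated at \<open>A\<close>.  The two
  conjugations make \<open>X \<mapsto> L(X\<^sup>*)\<^sup>*\<close> complex linear again.\<close>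

lemma is_frechet_deriv_conj_transpose:
  fixes A :: "complex^'n^'n"
  assumes S: "open S" and hol: "f holomorphic_on S" and eig: "eigenvalues A \<subseteq> S"
    and sym: "\<And>z. z \<in> S \<Longrightarrow> f (cnj z) = cnj (f z)"
    and L: "is_frechet_deriv f A L"
  shows "is_frechet_deriv f (conj_transpose A) (\<lambda>X. conj_transpose (L (conj_transpose X)))"
proof -
  let ?L = "\<lambda>X. conj_transpose (L (conj_transpose X))"
  have lin: "Vector_Spaces.linear matrix_scale matrix_scale L"
    using L by (simp add: is_frechet_deriv_def)
  then have "Vector_Spaces.linear matrix_scale matrix_scale ?L"
    by (simp add: Vector_Spaces.linear_iff conj_transpose_add conj_transpose_matrix_scale)
  moreover have "(\<lambda>\<epsilon>::real. norm (matrix_fun f (conj_transpose A + \<epsilon> *\<^sub>R E)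
      - matrix_fun f (conj_transpose A) - \<epsilon> *\<^sub>R ?L E)) \<in> O[at_right 0](\<lambda>\<epsilon>. \<epsilon>\<^sup>2)" for E
  proof -
    let ?E = "conj_transpose E"
    have "((\<lambda>\<epsilon>::real. A + \<epsilon> *\<^sub>R ?E) \<longlongrightarrow> A) (at_right 0)"
      by (auto intro!: tendsto_eq_intros)
    then have "\<forall>\<^sub>F \<epsilon> in at_right 0. eigenvalues (A + \<epsilon> *\<^sub>R ?E) \<subseteq> S"
      by (rule eventually_compose_filterlim[OF eventually_eigenvalues_subset[OF S eig]])
    then have "\<forall>\<^sub>F \<epsilon> in at_right 0.
        norm (matrix_fun f (conj_transpose A + \<epsilon> *\<^sub>R E) - matrix_fun f (conj_transpose A) - \<epsilon> *\<^sub>R ?L E)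
      = norm (matrix_fun f (A + \<epsilon> *\<^sub>R ?E) - matrix_fun f A - \<epsilon> *\<^sub>R L ?E)"
    proof eventually_elim
      case (elim \<epsilon>)
      have "matrix_fun f (conj_transpose A + \<epsilon> *\<^sub>R E) = conj_transpose (matrix_fun f (A + \<epsilon> *\<^sub>R ?E))"
        using matrix_fun_conj_transpose[OF S hol elim sym]
        by (simp add: conj_transpose_add conj_transpose_scaleR)
      then have "matrix_fun f (conj_transpose A + \<epsilon> *\<^sub>R E) - matrix_fun f (conj_transpose A) - \<epsilon> *\<^sub>R ?L E
          = conj_transpose (matrix_fun f (A + \<epsilon> *\<^sub>R ?E) - matrix_fun f A - \<epsilon> *\<^sub>R L ?E)"
        using matrix_fun_conj_transpose[OF S hol eig sym]
        by (simp add: conj_transpose_diff conj_transpose_scaleR)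
      then show ?case by simp
    qed
    moreover have "(\<lambda>\<epsilon>::real. norm (matrix_fun f (A + \<epsilon> *\<^sub>R ?E) - matrix_fun f A - \<epsilon> *\<^sub>R L ?E))
        \<in> O[at_right 0](\<lambda>\<epsilon>. \<epsilon>\<^sup>2)"
      using L by (simp add: is_frechet_deriv_def)
    ultimately show ?thesis
      by (subst landau_o.big.in_cong)
  qed
  ultimately show ?thesis
    by (simp add: is_frechet_deriv_def)
qed

section \<open>The adjoint identity\<close>

theorem theorem1p2:
  fixes f :: "complex \<Rightarrow> complex" and S :: "complex set"
    and A E :: "complex^'n^'n" and b c :: "complex^'n"
  assumes "open S" and "f analytic_on S"
    and "eigenvalues A \<subseteq> S" and "eigenvalues (conj_transpose A) \<subseteq> S"
    and conj_symmetric: "\<forall>z\<in>S. cnj z \<in> S \<longrightarrow> f (cnj z) = cnj (f z)"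
    and "frechet_well_defined f A"
  shows "conj_dot c (frechet_deriv f A E *v b)
       = trace_inner (frechet_deriv f (conj_transpose A) (conj_outer c b)) E"
proof -
  \<comment> \<open>on this open set, which still contains both spectra, \<open>f\<close> commutes with conjugation\<close>
  define S' where "S' = S \<inter> cnj -` S"
  have S': "open S'"
    unfolding S'_def using assms(1) by (intro open_Int open_vimage continuous_intros)
  have hol: "f holomorphic_on S'"
    using assms(2) by (auto simp: S'_def intro: analytic_imp_holomorphic analytic_on_subset)
  have eig: "eigenvalues A \<subseteq> S'" "eigenvalues (conj_transpose A) \<subseteq> S'"
    using assms(3,4) by (auto simp: S'_def eigenvalues_conj_transpose)
  have sym: "f (cnj z) = cnj (f z)" if "z \<in> S'" for z
    using that conj_symmetric by (auto simp: S'_def)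
  obtain L where L: "is_frechet_deriv f A L" and unique: "\<And>K. is_frechet_deriv f A K \<Longrightarrow> K = L"
    using assms(6) by (auto simp: frechet_well_defined_def)
  have deriv_A: "frechet_deriv f A = L"
    unfolding frechet_deriv_def using L unique by (rule the_equality)
  have deriv_adj: "frechet_deriv f (conj_transpose A) = (\<lambda>X. conj_transpose (L (conj_transpose X)))"
    unfolding frechet_deriv_def
  proof (rule the_equality)
    show "is_frechet_deriv f (conj_transpose A) (\<lambda>X. conj_transpose (L (conj_transpose X)))"
      by (rule is_frechet_deriv_conj_transpose[OF S' hol eig(1) sym L])
  next
    \<comment> \<open>uniqueness at \<open>A\<^sup>*\<close> is inherited from \<open>A\<close>: transposing twice returns to \<open>A\<close>\<close>
    fix K assume K: "is_frechet_deriv f (conj_transpose A) K"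
    have "(\<lambda>X. conj_transpose (K (conj_transpose X))) = L"
      using is_frechet_deriv_conj_transpose[OF S' hol eig(2) sym K] by (auto intro: unique)
    then show "K = (\<lambda>X. conj_transpose (L (conj_transpose X)))"
      by auto
  qed
  have outer: "conj_transpose (conj_outer c b) = conj_outer b c"
    by (simp add: vec_eq_iff conj_outer_def)
  \<comment> \<open>\<open>c\<^sup>* M b\<close> is the trace of \<open>(b c\<^sup>*) M\<close>, which brings the identity into trace form\<close>
  have "conj_dot c (L E *v b) = trace (conj_outer b c ** L E)"
    by (simp add: conj_dot_def conj_outer_def trace_def matrix_matrix_mult_def matrix_vector_mult_def
        sum_distrib_left sum_distrib_right mult_ac) (rule sum.swap)
  also have "\<dots> = trace (L (conj_outer b c) ** E)"
    using frechet_deriv_trace_symmetric[OF S' hol eig(1) L] by (metis trace_mul_sym)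
  finally show ?thesis
    by (simp add: trace_inner_def deriv_A deriv_adj outer)
qed

end
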